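(* Let $A:\mathbb{Z}^{+}\to M_d(\mathbb{R})$ and $f:\mathbb{Z}^{+}\times\mathbb{R}^d\to\mathbb{R}^d$ (with each $f(k,\cdot)$ continuous), and consider the systems $$(L)\quad x_{k+1}=A(k)x_k,\qquad (N)\quad y_{k+1}=A(k)y_k+f(k,y_k),\qquad k\in\mathbb{Z}^{+}.$$ Assume that: (P1) every $A(k)$ is invertible and there exists $M\ge 1$ with $\max\{\sup_{k\in\mathbb{Z}^{+}}\|A(k)\|,\ \sup_{k\in\mathbb{Z}^{+}}\|A^{-1}(k)\|\}=M$. (P3) There are sequences $\gamma,\mu$ of nonnegative reals such that for all $k\in\mathbb{Z}^{+}$ and $y,\tilde y\in\mathbb{R}^d$: $|f(k,y)-f(k,\tilde y)|\le\gamma(k)|y-\tilde y|$ and $|f(k,y)|\le\mu(k)$. (P6) $\|A^{-1}(\ell)\|\,\gamma(\ell)<1$ for all $\ell\in\mathbb{Z}^{+}$. (S1) There exist a bounded sequence $\rho$ of nonnegative reals and a decreasing sequence $h$ of positive reals converging to zero with $h(0)=1$ such that $\|\Phi(k,n)\|\le\rho(n)\frac{h(k)}{h(n)}$ for all $k\ge n\ge 0$. (S2) There is $p<\infty$ with $\sum_{j=0}^{k-1}\mu(j)\rho(j+1)\frac{h(k)}{h(j+1)}\le p$ for all $k\in\mathbb{Z}^{+}$. (S3) There is $q<1$ with $\sum_{j=0}^{k-1}\gamma(j)\rho(j+1)\frac{h(k)}{h(j+1)}\le q$ for all $k\in\mathbb{Z}^{+}$. (S4) $\displaystyle\lim_{k\to+\infty}h(k)\prod_{j=0}^{k-1}\Big(1+\gamma(j)\rho(j+1)\frac{h(j)}{h(j+1)}\Big)=0$.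 Let $H,G$ be the maps of the $\mathbb{Z}^{+}$-topological equivalence between $(L)$ and $(N)$ defined in the context. Then: (i) If the system $(N)$ has an equilibrium $y^{*}$, then it is unique. (ii) If $y^{*}=0$ is the equilibrium, that is, $f(n,0)=0$ for all $n\in\mathbb{Z}^{+}$, then $H(k,0)=G(k,0)=0$ for all $k\in\mathbb{Z}^{+}$. (iii) If $(N)$ has an equilibrium $y^{*}\neq 0$, then $\lim_{k\to+\infty}H(k,0)=y^{*}$ and $\lim_{k\to+\infty}G(k,y^{*})=0$.
   Context: $\mathbb{Z}^{+}=\{0,1,2,\dots\}$; $|\cdot|$ is a vector norm on $\mathbb{R}^d$ and $\|\cdot\|$ its induced matrix norm; $A^{-1}(k)$ denotes $(A(k))^{-1}$. Transition matrix of $(L)$: $\Phi(k,n)=A(k-1)A(k-2)\cdots A(n)$ if $k>n$; $\Phi(k,k)=I$; $\Phi(k,n)=A^{-1}(k)A^{-1}(k+1)\cdots A^{-1}(n-1)$ if $k<n$. $k\mapsto x(k,m,\xi)=\Phi(k,m)\xi$ and $k\mapsto y(k,m,\eta)$, $k\in\mathbb{Z}^{+}$, denote the solutions of $(L)$ and $(N)$ with values $\xi$ and $\eta$, respectively, at $k=m$ (by (P6), solutions of $(N)$ are uniquely defined for $k<m$ as well). An equilibrium of $(N)$ is a vector $y^{*}\in\mathbb{R}^d$ with $y^{*}=A(n)y^{*}+f(n,y^{*})$ for all $n\in\mathbb{Z}^{+}$. The maps $H,G:\mathbb{Z}^{+}\times\mathbb{R}^d\to\mathbb{R}^d$ are $H(k,\xi)=y(k,0,x(0,k,\xi))$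 and $G(k,\xi)=x(k,0,y(0,k,\xi))=\Phi(k,0)\,y(0,k,\xi)$; they are the mutually inverse maps realizing the topological equivalence between $(L)$ and $(N)$ ($H$ maps solutions of $(L)$ to solutions of $(N)$, $G$ conversely). *)

theory Defs
  imports "HOL-Analysis.Analysis"
begin

definition is_vector_norm :: "(real^'d \<Rightarrow> real) \<Rightarrow> bool" where
  "is_vector_norm N \<longleftrightarrow>
     (\<forall>x. 0 \<le> N x) \<and> (\<forall>x. N x = 0 \<longleftrightarrow> x = 0) \<and>
     (\<forall>c x. N (c *\<^sub>R x) = \<bar>c\<bar> * N x) \<and> (\<forall>x y. N (x + y) \<le> N x + N y)"

definition induced_norm :: "(real^'d \<Rightarrow> real) \<Rightarrow> real^'d^'d \<Rightarrow> real" where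
  "induced_norm N B = (SUP x\<in>{x. N x = 1}. N (B *v x))"

(* forward_prod A n i = A(n+i-1) ... A(n)   (i factors) *)
primrec forward_prod :: "(nat \<Rightarrow> real^'d^'d) \<Rightarrow> nat \<Rightarrow> nat \<Rightarrow> real^'d^'d" where
  "forward_prod A n 0 = mat 1"
| "forward_prod A n (Suc i) = A (n + i) ** forward_prod A n i"

(* backward_prod A k i = A(k)^{-1} ... A(k+i-1)^{-1}   (i factors) *)
primrec backward_prod :: "(nat \<Rightarrow> real^'d^'d) \<Rightarrow> nat \<Rightarrow> nat \<Rightarrow> real^'d^'d" where
  "backward_prod A k 0 = mat 1"
| "backward_prod A k (Suc i) = backward_prod A k i ** matrix_inv (A (k + i))"

definition transition :: "(nat \<Rightarrow> real^'d^'d) \<Rightarrow> nat \<Rightarrow> nat \<Rightarrow> real^'d^'d" where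
  "transition A k n = (if n \<le> k then forward_prod A n (k - n) else backward_prod A k (n - k))"

definition lin_sol :: "(nat \<Rightarrow> real^'d^'d) \<Rightarrow> nat \<Rightarrow> nat \<Rightarrow> real^'d \<Rightarrow> real^'d" where
  "lin_sol A k m \<xi> = transition A k m *v \<xi>"

definition is_nonlin_solution ::
  "(nat \<Rightarrow> real^'d^'d) \<Rightarrow> (nat \<Rightarrow> real^'d \<Rightarrow> real^'d) \<Rightarrow> (nat \<Rightarrow> real^'d) \<Rightarrow> bool" where
  "is_nonlin_solution A f y \<longleftrightarrow> (\<forall>k. y (Suc k) = A k *v y k + f k (y k))"

(* nonlin_sol A f k m \<eta> is the value at k of the solution y on all of nat with y(m) = \<eta>.
   For the indices below m, existence and uniqueness of the solution are not automatic; they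
   hold when every A(l) is invertible and ||A(l)^{-1}|| times the Lipschitz constant of f(l, .)
   is less than 1. *)
definition nonlin_sol ::
  "(nat \<Rightarrow> real^'d^'d) \<Rightarrow> (nat \<Rightarrow> real^'d \<Rightarrow> real^'d) \<Rightarrow> nat \<Rightarrow> nat \<Rightarrow> real^'d \<Rightarrow> real^'d" where
  "nonlin_sol A f k m \<eta> = (THE y. is_nonlin_solution A f y \<and> y m = \<eta>) k"

definition is_equilibrium ::
  "(nat \<Rightarrow> real^'d^'d) \<Rightarrow> (nat \<Rightarrow> real^'d \<Rightarrow> real^'d) \<Rightarrow> real^'d \<Rightarrow> bool" where
  "is_equilibrium A f y \<longleftrightarrow> (\<forall>n. y = A n *v y + f n y)"

definition H_map ::
  "(nat \<Rightarrow> real^'d^'d) \<Rightarrow> (nat \<Rightarrow> real^'d \<Rightarrow> real^'d) \<Rightarrow> nat \<Rightarrow> real^'d \<Rightarrow> real^'d" where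
  "H_map A f k \<xi> = nonlin_sol A f k 0 (lin_sol A 0 k \<xi>)"

definition G_map ::
  "(nat \<Rightarrow> real^'d^'d) \<Rightarrow> (nat \<Rightarrow> real^'d \<Rightarrow> real^'d) \<Rightarrow> nat \<Rightarrow> real^'d \<Rightarrow> real^'d" where
  "G_map A f k \<xi> = lin_sol A k 0 (nonlin_sol A f 0 k \<xi>)"

end

theory Submission
  imports Defs
begin

text \<open>
  The difference \<open>z\<close> of two solutions of (N) solves the linear system (L) with the forcing term
  \<open>g j = f j (y j) - f j (y' j)\<close>, whose size is at most \<open>\<gamma> j * nrm (z j)\<close>. By the variation of
  constants formula (\<open>variation_of_constants\<close>) and the decay estimate on \<open>transition\<close>, the
  rescaled size \<open>nrm (z k) / h k\<close> satisfies a discrete Gronwall inequality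
  (\<open>discrete_gronwall\<close>). Hence \<open>nrm (z k)\<close> is at most a constant times the sequence that tends to
  zero by hypothesis: any two solutions of (N) approach each other
  (\<open>nonlin_solutions_attract\<close>).

  An equilibrium is a constant solution. Two equilibria have a constant difference, which must
  then be zero. The map \<open>H\<close> sends \<open>(k, 0)\<close> to the value at \<open>k\<close> of the solution of (N)
  that starts at the origin, and this solution approaches the equilibrium. The map \<open>G\<close> sends
  \<open>(k, y)\<close>, with \<open>y\<close> an equilibrium, to \<open>transition A k 0 *v y\<close>, which tends to zero with \<open>h\<close>.
  Here one must know that the solution through \<open>y\<close> at time \<open>k\<close> is the constant one also before
  \<open>k\<close>; that is where the invertibility of \<open>A l\<close> and the smallness of \<open>\<gamma> l\<close> enter: they make each
  step of (N) injective (\<open>step_injective\<close>), so that a solution is determined by any one of its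
  values (\<open>nonlin_sol_eqI\<close>).
\<close>

section \<open>Norms on a finite-dimensional space\<close>

lemma is_vector_normD:
  assumes "is_vector_norm N"
  shows "0 \<le> N x" "N x = 0 \<longleftrightarrow> x = 0" "N (c *\<^sub>R x) = \<bar>c\<bar> * N x" "N (x + y) \<le> N x + N y"
  using assms by (auto simp: is_vector_norm_def)

lemma vector_norm_sum:
  assumes "is_vector_norm N"
  shows "N (sum g S) \<le> (\<Sum>j\<in>S. N (g j))"
proof (induction S rule: infinite_finite_induct)
  case (insert x F)
  then show ?case
    using is_vector_normD(4)[OF assms, of "g x" "sum g F"] by simp
qed (simp_all add: is_vector_normD(2)[OF assms, THEN iffD2])

text \<open>A norm is a convex function, hence continuous, hence bounded and bounded away from zero on
  the Euclidean unit sphere; homogeneity extends the two bounds to all vectors.\<close>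

lemma vector_norm_equivalent:
  fixes N :: "real^'d \<Rightarrow> real"
  assumes N: "is_vector_norm N"
  obtains c K where "0 < c" "0 < K" "\<And>x. c * norm x \<le> N x" "\<And>x. N x \<le> K * norm x"
proof -
  have "convex_on UNIV N"
  proof (rule convex_onI)
    fix t :: real and x y :: "real^'d"
    assume "0 < t" "t < 1"
    then show "N ((1 - t) *\<^sub>R x + t *\<^sub>R y) \<le> (1 - t) * N x + t * N y"
      using is_vector_normD(4)[OF N, of "(1 - t) *\<^sub>R x" "t *\<^sub>R y"]
      by (simp add: is_vector_normD(3)[OF N])
  qed simp
  then have "continuous_on UNIV N"
    by (intro convex_on_continuous) auto
  then have cont: "continuous_on (sphere 0 1) N"
    by (rule continuous_on_subset) simp
  have sphere: "compact (sphere (0::real^'d) 1)" "sphere (0::real^'d) 1 \<noteq> {}"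
    by auto
  obtain a where a: "a \<in> sphere 0 1" "\<And>x. x \<in> sphere 0 1 \<Longrightarrow> N a \<le> N x"
    using continuous_attains_inf[OF sphere cont] by blast
  obtain b where b: "b \<in> sphere 0 1" "\<And>x. x \<in> sphere 0 1 \<Longrightarrow> N x \<le> N b"
    using continuous_attains_sup[OF sphere cont] by blast
  have pos: "0 < N x" if "x \<in> sphere 0 1" for x
    using that is_vector_normD(1,2)[OF N, of x] by (cases "x = 0") auto
  have bounds: "N a * norm x \<le> N x \<and> N x \<le> N b * norm x" for x
  proof (cases "x = 0")
    case True
    then show ?thesis using is_vector_normD(2)[OF N, of 0] by simp
  next
    case False
    define u where "u = (1 / norm x) *\<^sub>R x"
    have "u \<in> sphere 0 1" and "x = norm x *\<^sub>R u"
      using False by (auto simp: u_def)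
    then have "N x = N u * norm x"
      by (metis is_vector_normD(3)[OF N] abs_norm_cancel mult.commute)
    with \<open>u \<in> sphere 0 1\<close> show ?thesis
      using a(2)[of u] b(2)[of u] by (simp add: mult_right_mono)
  qed
  show thesis
    using that[OF pos[OF a(1)] pos[OF b(1)]] bounds by blast
qed

text \<open>The supremum that defines the induced norm is over a bounded set, so that it is a genuine
  upper bound and not an arbitrary default value.\<close>

lemma induced_norm_bound:
  assumes N: "is_vector_norm N"
  shows "N (B *v x) \<le> induced_norm N B * N x"
proof (cases "x = 0")
  case True
  then show ?thesis using is_vector_normD(2)[OF N, of 0] by simp
next
  case False
  obtain c K where cK: "0 < c" "0 < K" "\<And>x. c * norm x \<le> N x" "\<And>x. N x \<le> K * norm x"
    using vector_norm_equivalent[OF N] by blast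
  obtain L where L: "\<And>x. norm (B *v x) \<le> norm x * L" "0 < L"
    using bounded_linear.pos_bounded[OF matrix_vector_mul_bounded_linear[of B]] by blast
  have bdd: "bdd_above ((\<lambda>x. N (B *v x)) ` {x. N x = 1})"
  proof (rule bdd_aboveI2)
    fix x assume "x \<in> {x. N x = 1}"
    then have "norm x \<le> 1 / c"
      using cK(1) cK(3)[of x] by (simp add: field_simps)
    have "N (B *v x) \<le> K * (norm x * L)"
      using cK(4)[of "B *v x"] L(1)[of x] cK(2) by (meson mult_left_mono order.trans less_imp_le)
    also have "\<dots> \<le> K * (1 / c * L)"
      using \<open>norm x \<le> 1 / c\<close> cK(2) L(2) by (intro mult_left_mono mult_right_mono) auto
    finally show "N (B *v x) \<le> K * (1 / c * L)" .
  qed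
  have pos: "0 < N x"
    using False is_vector_normD(1,2)[OF N, of x] by linarith
  define u where "u = (1 / N x) *\<^sub>R x"
  have "N u = 1"
    using pos by (simp add: u_def is_vector_normD(3)[OF N])
  then have "N (B *v u) \<le> induced_norm N B"
    unfolding induced_norm_def by (intro cSUP_upper bdd) simp
  then show ?thesis
    using pos by (simp add: u_def matrix_vector_mult_scaleR is_vector_normD(3)[OF N] field_simps)
qed

lemma tendsto_if_vector_norm_dominated:
  fixes N :: "real^'d \<Rightarrow> real"
  assumes N: "is_vector_norm N"
    and le: "\<And>k. N (y k - l) \<le> C * e k" and e: "e \<longlonglongrightarrow> 0"
  shows "y \<longlonglongrightarrow> l"
proof -
  obtain c K where c: "0 < c" "0 < K" "\<And>x. c * norm x \<le> N x" "\<And>x. N x \<le> K * norm x"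
    using vector_norm_equivalent[OF N] by blast
  have "norm (y k - l) \<le> C / c * e k" for k
    using c(1) c(3)[of "y k - l"] le[of k] by (simp add: field_simps)
  then have le': "\<forall>\<^sub>F k in sequentially. norm (y k - l) \<le> C / c * e k"
    by simp
  have "(\<lambda>k. C / c * e k) \<longlonglongrightarrow> 0"
    using tendsto_mult_left[OF e, of "C / c"] by simp
  with le' have "(\<lambda>k. y k - l) \<longlonglongrightarrow> 0"
    by (rule Lim_null_comparison)
  then show ?thesis
    by (rule LIM_zero_cancel)
qed

section \<open>Variation of constants and a discrete Gronwall inequality\<close>

lemma transition_self [simp]: "transition A k k = mat 1"
  by (simp add: transition_def)

lemma transition_Suc: "n \<le> k \<Longrightarrow> transition A (Suc k) n = A k ** transition A k n"
  by (simp add: transition_def Suc_diff_le)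

lemma variation_of_constants:
  assumes "\<And>k. z (Suc k) = A k *v z k + g k"
  shows "z k = transition A k 0 *v z 0 + (\<Sum>j<k. transition A k (Suc j) *v g j)"
proof (induction k)
  case (Suc k)
  have "(\<Sum>j<k. transition A (Suc k) (Suc j) *v g j)
      = A k *v (\<Sum>j<k. transition A k (Suc j) *v g j)"
    unfolding linear_sum[OF matrix_vector_mul_linear]
    by (intro sum.cong) (auto simp: transition_Suc matrix_vector_mul_assoc)
  then show ?case
    by (simp add: assms[of k] transition_Suc Suc.IH matrix_vector_right_distrib matrix_vector_mul_assoc)
qed simp

text \<open>The right-hand side \<open>v k = C * (\<Prod>j<k. 1 + a j)\<close> is the sequence for which the hypothesis
  holds with equality.\<close>

lemma discrete_gronwall:
  fixes u a :: "nat \<Rightarrow> real"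
  assumes le: "\<And>k. u k \<le> C + (\<Sum>j<k. a j * u j)" and a: "\<And>k. 0 \<le> a k"
  shows "u k \<le> C * (\<Prod>j<k. 1 + a j)"
proof (induction k rule: less_induct)
  case (less k)
  define v where "v = (\<lambda>k. C * (\<Prod>j<k. 1 + a j))"
  have v: "C + (\<Sum>j<k. a j * v j) = v k" for k
    by (induction k) (auto simp: v_def algebra_simps)
  have "u k \<le> C + (\<Sum>j<k. a j * u j)"
    by (rule le)
  also have "\<dots> \<le> C + (\<Sum>j<k. a j * v j)"
  proof (intro add_left_mono sum_mono mult_left_mono a)
    fix j assume "j \<in> {..<k}"
    then show "u j \<le> v j"
      unfolding v_def by (intro less.IH) simp
  qed
  also have "\<dots> = C * (\<Prod>j<k. 1 + a j)"
    using v[of k] by (simp only: v_def)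
  finally show ?case .
qed

section \<open>Solutions of the nonlinear system\<close>

text \<open>The step \<open>v \<mapsto> B *v v + g v\<close> is a perturbation of an invertible linear map. If two vectors
  have the same image, then their difference is \<open>matrix_inv B\<close> applied to a difference of values
  of \<open>g\<close>, and is therefore strictly smaller than itself unless it vanishes.\<close>

lemma step_injective:
  assumes N: "is_vector_norm N" and B: "invertible B"
    and lip: "\<And>v w. N (g v - g w) \<le> c * N (v - w)"
    and small: "induced_norm N (matrix_inv B) * c < 1" and c: "0 \<le> c"
  shows "inj (\<lambda>v. B *v v + g v)"
proof (rule injI)
  fix v w assume eq: "B *v v + g v = B *v w + g w"
  let ?m = "induced_norm N (matrix_inv B)"
  have inv: "matrix_inv B ** B = mat 1"
    using someI_ex[OF B[unfolded invertible_def]] by (simp add: matrix_inv_def)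
  have "v - w = matrix_inv B *v (B *v (v - w))"
    by (simp add: matrix_vector_mul_assoc inv)
  also have "B *v (v - w) = g w - g v"
    using eq by (simp add: matrix_vector_mult_diff_distrib algebra_simps)
  finally have vw: "v - w = matrix_inv B *v (g w - g v)" .
  show "v = w"
  proof (rule ccontr)
    assume "v \<noteq> w"
    then have pos: "0 < N (v - w)"
      using is_vector_normD(1,2)[OF N, of "v - w"] by (simp add: less_le)
    have swap: "N (w - v) = N (v - w)"
      using is_vector_normD(3)[OF N, of "-1" "v - w"] by simp
    have le: "N (v - w) \<le> ?m * N (g w - g v)"
      using induced_norm_bound[OF N, of "matrix_inv B" "g w - g v"] vw by simp
    have "0 < ?m"
      using le pos mult_nonpos_nonneg[of ?m, OF _ is_vector_normD(1)[OF N, of "g w - g v"]]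
      by linarith
    then have "N (v - w) \<le> ?m * (c * N (v - w))"
      using le mult_left_mono[OF lip[of w v], of ?m] unfolding swap by linarith
    also have "\<dots> < N (v - w)"
      using mult_strict_right_mono[OF small pos] by (simp add: mult.assoc)
    finally show False by simp
  qed
qed

text \<open>Injectivity of the steps makes agreement of two solutions pass from time \<open>Suc n\<close> back to
  time \<open>n\<close>, so that the description that defines \<open>nonlin_sol\<close> has at most one solution,
  whatever the initial time \<open>m\<close>.\<close>

lemma nonlin_sol_eqI:
  assumes y: "is_nonlin_solution A f y" and inj: "\<And>n. inj (\<lambda>v. A n *v v + f n v)"
  shows "nonlin_sol A f k m (y m) = y k"
proof -
  have "z = y" if z: "is_nonlin_solution A f z" and "z m = y m" for z
  proof
    fix k
    have step: "z (Suc n) = y (Suc n) \<longleftrightarrow> z n = y n" for n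
      using z y injD[OF inj[of n], of "z n" "y n"] by (auto simp: is_nonlin_solution_def)
    have "z n = y n \<longleftrightarrow> z 0 = y 0" for n
      by (induction n) (auto simp: step)
    then show "z k = y k"
      using \<open>z m = y m\<close> by metis
  qed
  then have "(THE z. is_nonlin_solution A f z \<and> z m = y m) = y"
    using y by (intro the_equality) auto
  then show ?thesis
    by (simp add: nonlin_sol_def)
qed

lemma nonlin_solution_from:
  obtains y where "is_nonlin_solution A f y" "y 0 = \<xi>"
  using that[of "rec_nat \<xi> (\<lambda>k v. A k *v v + f k v)"]
  by (simp add: is_nonlin_solution_def)

lemma equilibrium_constant_solution:
  "is_equilibrium A f y \<Longrightarrow> is_nonlin_solution A f (\<lambda>_. y)"
  by (simp add: is_equilibrium_def is_nonlin_solution_def)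

text \<open>Division by \<open>h k\<close> removes the dependence of the kernel on \<open>k\<close> in the variation of constants
  estimate; this is what makes the Gronwall inequality applicable.\<close>

lemma nonlin_solutions_attract:
  fixes \<rho> h \<gamma> :: "nat \<Rightarrow> real"
  assumes N: "is_vector_norm N"
    and lip: "\<And>k v w. N (f k v - f k w) \<le> \<gamma> k * N (v - w)" and \<gamma>: "\<And>k. 0 \<le> \<gamma> k"
    and \<rho>: "\<And>k. 0 \<le> \<rho> k" and h: "\<And>k. 0 < h k"
    and decay: "\<And>k n. n \<le> k \<Longrightarrow> induced_norm N (transition A k n) \<le> \<rho> n * (h k / h n)"
    and y: "is_nonlin_solution A f y" and y': "is_nonlin_solution A f y'"
  shows "N (y k - y' k) \<le> \<rho> 0 * N (y 0 - y' 0) / h 0 *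
    (h k * (\<Prod>j<k. 1 + \<gamma> j * \<rho> (j + 1) * (h j / h (j + 1))))"
proof -
  define z where "z = (\<lambda>k. y k - y' k)"
  define g where "g = (\<lambda>k. f k (y k) - f k (y' k))"
  define C where "C = \<rho> 0 * N (z 0) / h 0"
  define a where "a = (\<lambda>j. \<gamma> j * \<rho> (j + 1) * (h j / h (j + 1)))"
  have rec: "z (Suc k) = A k *v z k + g k" for k
    using y y' by (simp add: z_def g_def is_nonlin_solution_def matrix_vector_mult_diff_distrib)
  have transition_le: "N (transition A k n *v x) \<le> \<rho> n * (h k / h n) * N x" if "n \<le> k" for k n x
    using induced_norm_bound[OF N, of "transition A k n" x] decay[OF that]
      mult_right_mono[OF decay[OF that] is_vector_normD(1)[OF N, of x]] by linarith
  have "N (z k) / h k \<le> C + (\<Sum>j<k. a j * (N (z j) / h j))" for k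
  proof -
    have "N (z k) \<le> N (transition A k 0 *v z 0) + (\<Sum>j<k. N (transition A k (Suc j) *v g j))"
      unfolding variation_of_constants[of z A g k, OF rec]
      by (intro order.trans[OF is_vector_normD(4)[OF N]] add_left_mono vector_norm_sum[OF N])
    also have "\<dots> \<le> \<rho> 0 * (h k / h 0) * N (z 0)
        + (\<Sum>j<k. \<rho> (Suc j) * (h k / h (Suc j)) * (\<gamma> j * N (z j)))"
    proof (intro add_mono sum_mono)
      show "N (transition A k 0 *v z 0) \<le> \<rho> 0 * (h k / h 0) * N (z 0)"
        by (rule transition_le) simp
    next
      fix j assume "j \<in> {..<k}"
      then have "N (transition A k (Suc j) *v g j) \<le> \<rho> (Suc j) * (h k / h (Suc j)) * N (g j)"
        by (intro transition_le) simp
      also have "\<dots> \<le> \<rho> (Suc j) * (h k / h (Suc j)) * (\<gamma> j * N (z j))"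
        using \<rho>[of "Suc j"] h[of k] h[of "Suc j"] lip[of j "y j" "y' j"]
        by (intro mult_left_mono) (auto simp: g_def z_def)
      finally show "N (transition A k (Suc j) *v g j)
          \<le> \<rho> (Suc j) * (h k / h (Suc j)) * (\<gamma> j * N (z j))" .
    qed
    also have "\<dots> = h k * (C + (\<Sum>j<k. a j * (N (z j) / h j)))"
    proof -
      have "\<rho> (Suc j) * (h k / h (Suc j)) * (\<gamma> j * N (z j)) = h k * (a j * (N (z j) / h j))" for j
        using h[of j] by (simp add: a_def)
      moreover have "\<rho> 0 * (h k / h 0) * N (z 0) = h k * C"
        by (simp add: C_def)
      ultimately show ?thesis
        by (simp add: distrib_left sum_distrib_left)
    qed
    finally show ?thesis
      using h[of k] by (simp add: pos_divide_le_eq mult.commute)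
  qed
  moreover have "0 \<le> a j" for j
    using \<gamma>[of j] \<rho>[of "j + 1"] h[of j] h[of "j + 1"] by (simp add: a_def)
  ultimately have "N (z k) / h k \<le> C * (\<Prod>j<k. 1 + a j)"
    by (rule discrete_gronwall)
  then show ?thesis
    using h[of k] by (simp add: pos_divide_le_eq z_def C_def a_def mult_ac)
qed

section \<open>Equilibria and the equivalence maps\<close>

theorem theorem2:
  fixes nrm :: "real^'d \<Rightarrow> real"
    and A :: "nat \<Rightarrow> real^'d^'d"
    and f :: "nat \<Rightarrow> real^'d \<Rightarrow> real^'d"
    and \<gamma> \<mu> \<rho> h :: "nat \<Rightarrow> real"
    and M p q :: real
  assumes nrm: "is_vector_norm nrm"
    and f_cont: "\<And>k. continuous_on UNIV (f k)"
    and P1: "\<And>k. invertible (A k)"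
      "bdd_above (range (\<lambda>k. induced_norm nrm (A k)))"
      "bdd_above (range (\<lambda>k. induced_norm nrm (matrix_inv (A k))))"
      "max (SUP k. induced_norm nrm (A k)) (SUP k. induced_norm nrm (matrix_inv (A k))) = M"
      "M \<ge> 1"
    and P3: "\<And>k. \<gamma> k \<ge> 0" "\<And>k. \<mu> k \<ge> 0"
      "\<And>k y y'. nrm (f k y - f k y') \<le> \<gamma> k * nrm (y - y')"
      "\<And>k y. nrm (f k y) \<le> \<mu> k"
    and P6: "\<And>l. induced_norm nrm (matrix_inv (A l)) * \<gamma> l < 1"
    and S1: "\<And>k. \<rho> k \<ge> 0" "bdd_above (range \<rho>)"
      "\<And>k. h k > 0" "decseq h" "h \<longlonglongrightarrow> 0" "h 0 = 1"
      "\<And>k n. n \<le> k \<Longrightarrow> induced_norm nrm (transition A k n) \<le> \<rho> n * (h k / h n)"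
    and S2: "\<And>k. (\<Sum>j<k. \<mu> j * \<rho> (j + 1) * (h k / h (j + 1))) \<le> p"
    and S3: "q < 1" "\<And>k. (\<Sum>j<k. \<gamma> j * \<rho> (j + 1) * (h k / h (j + 1))) \<le> q"
    and S4: "(\<lambda>k. h k * (\<Prod>j<k. 1 + \<gamma> j * \<rho> (j + 1) * (h j / h (j + 1)))) \<longlonglongrightarrow> 0"
  shows "((\<exists>y. is_equilibrium A f y) \<longrightarrow> (\<exists>!y. is_equilibrium A f y)) \<and>
    (is_equilibrium A f 0 \<longleftrightarrow> (\<forall>n. f n 0 = 0)) \<and>
    (is_equilibrium A f 0 \<longrightarrow> (\<forall>k. H_map A f k 0 = 0 \<and> G_map A f k 0 = 0)) \<and>
    (\<forall>y. is_equilibrium A f y \<and> y \<noteq> 0 \<longrightarrow>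
       (\<lambda>k. H_map A f k 0) \<longlonglongrightarrow> y \<and> (\<lambda>k. G_map A f k y) \<longlonglongrightarrow> 0)"
proof -
  define e where "e = (\<lambda>k. h k * (\<Prod>j<k. 1 + \<gamma> j * \<rho> (j + 1) * (h j / h (j + 1))))"
  have e: "e \<longlonglongrightarrow> 0"
    using S4 by (simp add: e_def)
  have inj: "inj (\<lambda>v. A n *v v + f n v)" for n
    by (rule step_injective[OF nrm P1(1) P3(3) P6 P3(1)])
  have attract: "nrm (y k - y' k) \<le> \<rho> 0 * nrm (y 0 - y' 0) / h 0 * e k"
    if "is_nonlin_solution A f y" "is_nonlin_solution A f y'" for y y' k
    unfolding e_def
    by (rule nonlin_solutions_attract[of nrm f \<gamma> \<rho> h A y y'])
      (use that nrm P3(1,3) S1(1,3,7) in auto)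
  \<comment> \<open>Every solution converges to every equilibrium, so that limits identify equilibria.\<close>
  have to_equilibrium: "z \<longlonglongrightarrow> y" if "is_nonlin_solution A f z" "is_equilibrium A f y" for z y
    using attract[OF that(1) equilibrium_constant_solution[OF that(2)]]
    by (rule tendsto_if_vector_norm_dominated[OF nrm _ e])
  have unique: "y = y'" if "is_equilibrium A f y" "is_equilibrium A f y'" for y y'
    using to_equilibrium[OF equilibrium_constant_solution[OF that(1)] that(2)]
    by (simp add: LIMSEQ_const_iff)
  obtain z where z: "is_nonlin_solution A f z" "z 0 = 0"
    using nonlin_solution_from by blast
  have H: "H_map A f k 0 = z k" for k
    using nonlin_sol_eqI[OF z(1) inj, of k 0] z(2) by (simp add: H_map_def lin_sol_def)
  have G: "G_map A f k y = transition A k 0 *v y" if "is_equilibrium A f y" for k y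
    using nonlin_sol_eqI[OF equilibrium_constant_solution[OF that] inj, of 0 k]
    by (simp add: G_map_def lin_sol_def)
  have G_lim: "(\<lambda>k. G_map A f k y) \<longlonglongrightarrow> 0" if "is_equilibrium A f y" for y
  proof (rule tendsto_if_vector_norm_dominated[OF nrm _ S1(5)])
    fix k
    have "nrm (transition A k 0 *v y) \<le> induced_norm nrm (transition A k 0) * nrm y"
      by (rule induced_norm_bound[OF nrm])
    also have "\<dots> \<le> \<rho> 0 * (h k / h 0) * nrm y"
      by (intro mult_right_mono S1(7) is_vector_normD(1)[OF nrm]) simp
    finally show "nrm (G_map A f k y - 0) \<le> \<rho> 0 * nrm y * h k"
      using S1(6) by (simp add: G[OF that] mult_ac)
  qed
  have zero: "H_map A f k 0 = 0 \<and> G_map A f k 0 = 0" if "is_equilibrium A f 0" for k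
  proof
    show "H_map A f k 0 = 0"
      using nonlin_sol_eqI[OF equilibrium_constant_solution[OF that] inj, of k 0]
      by (simp add: H_map_def lin_sol_def)
    show "G_map A f k 0 = 0"
      by (simp add: G[OF that])
  qed
  show ?thesis
  proof (intro conjI impI allI)
    show "\<exists>!y. is_equilibrium A f y" if "\<exists>y. is_equilibrium A f y"
      using that unique by blast
    show "is_equilibrium A f 0 \<longleftrightarrow> (\<forall>n. f n 0 = 0)"
      by (auto simp: is_equilibrium_def)
    show "H_map A f k 0 = 0" "G_map A f k 0 = 0" if "is_equilibrium A f 0" for k
      using zero[OF that] by simp_all
    show "(\<lambda>k. H_map A f k 0) \<longlonglongrightarrow> y" "(\<lambda>k. G_map A f k y) \<longlonglongrightarrow> 0"
      if "is_equilibrium A f y \<and> y \<noteq> 0" for y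
      using to_equilibrium[OF z(1)] G_lim that by (simp_all add: H)
  qed
qed

end
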